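(* Let $s$, $m$, $n$, $k$, $w$ and $e$ be positive integers. Suppose that $G$ is a $k$-regular graph satisfying the following conditions. (1) Any two adjacent vertices have exactly $w$ common neighbors. (2) Any two distinct non-adjacent vertices have at most $e+1$ common neighbors. (3) $w>(s-1)e+ms-1$. (4) $k<(s+1)(w+1)-\frac{s(s+1)}{2}e$. (5) $ms+1\geq e+n$. (6) $e>m$. (7) For every vertex $x\in V(G)$, the local graph $N_G(x)$ is $\tilde K_{m+1,n}$-free. Define a line to be a maximal clique of $G$ with at least $w+2-(s-1)m$ vertices. Then every vertex of $G$ is on at most $s$ lines, and any two adjacent vertices occur together in a unique line.
   Context: All graphs are finite, undirected and simple. For a vertex $x$ of $G$, the local graph $N_G(x)$ is the subgraph of $G$ induced on the set of neighbors of $x$. A clique is a set of pairwise adjacent vertices (equivalently, the complete subgraph induced on it); a maximal clique is one maximal under inclusion. A vertex is on a line if it belongs to the corresponding clique. For positive integers $a,b$, $\tilde K_{a,b}$ is the graph on $a+b+1$ vertices consisting of a complete graph $K_{a+b}$ together with one further vertex $\infty$ that is adjacent to exactly $a$ vertices of the $K_{a+b}$. A graph is $\tilde K_{a,b}$-free if it has no induced subgraph isomorphic to $\tilde K_{a,b}$. *)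

theory Defs
  imports Complex_Main "Graph_Theory.Graph_Theory"
begin

text \<open>
  A finite simple undirected graph is an instance of the library locale \<^locale>\<open>graph\<close>:
  a finite symmetric digraph without loops and without parallel arcs, in which an undirected
  edge is a pair of opposite arcs. Adjacency is \<^const>\<open>dominates\<close>.
\<close>

definition neighbors :: "('a, 'b) pre_digraph \<Rightarrow> 'a \<Rightarrow> 'a set" where
  "neighbors G x = {y. x \<rightarrow>\<^bsub>G\<^esub> y}"

definition common_neighbors :: "('a, 'b) pre_digraph \<Rightarrow> 'a \<Rightarrow> 'a \<Rightarrow> 'a set" where
  "common_neighbors G x y = neighbors G x \<inter> neighbors G y"

text \<open>By \<open>out_degree_eq_card_neighbors\<close> below, the out-degree is the usual degree of a vertex.\<close>

definition regular :: "nat \<Rightarrow> ('a, 'b) pre_digraph \<Rightarrow> bool" where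
  "regular k G \<longleftrightarrow> (\<forall>x \<in> verts G. out_degree G x = k)"

definition local_graph :: "('a, 'b) pre_digraph \<Rightarrow> 'a \<Rightarrow> ('a, 'b) pre_digraph" where
  "local_graph G x = G \<restriction> neighbors G x"

definition clique :: "('a, 'b) pre_digraph \<Rightarrow> 'a set \<Rightarrow> bool" where
  "clique G C \<longleftrightarrow> C \<subseteq> verts G \<and> (\<forall>x \<in> C. \<forall>y \<in> C. x \<noteq> y \<longrightarrow> x \<rightarrow>\<^bsub>G\<^esub> y)"

definition maximal_clique :: "('a, 'b) pre_digraph \<Rightarrow> 'a set \<Rightarrow> bool" where
  "maximal_clique G C \<longleftrightarrow> clique G C \<and> (\<forall>D. clique G D \<and> C \<subseteq> D \<longrightarrow> D = C)"

text \<open>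
  The vertex \<open>\<infinity>\<close> is \<^const>\<open>None\<close>; the complete graph lives on \<open>Some 0, ..., Some (a + b - 1)\<close>,
  and the neighbors of \<open>\<infinity>\<close> are the first \<open>a\<close> of these.
\<close>

definition K_tilde :: "nat \<Rightarrow> nat \<Rightarrow> nat option pair_pre_digraph" where
  "K_tilde a b =
    \<lparr> pverts = insert None (Some ` {..<a + b}),
      parcs = {(Some i, Some j) | i j. i < a + b \<and> j < a + b \<and> i \<noteq> j}
        \<union> {(None, Some i) | i. i < a} \<union> {(Some i, None) | i. i < a} \<rparr>"

definition K_tilde_free :: "nat \<Rightarrow> nat \<Rightarrow> ('a, 'b) pre_digraph \<Rightarrow> bool" where
  "K_tilde_free a b G \<longleftrightarrow>
    \<not> (\<exists>H. induced_subgraph H G \<and> digraph_iso H (with_proj (K_tilde a b)))"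

text \<open>The size bound is taken over the integers, so that no subtraction truncates.\<close>

definition is_line :: "('a, 'b) pre_digraph \<Rightarrow> nat \<Rightarrow> nat \<Rightarrow> nat \<Rightarrow> 'a set \<Rightarrow> bool" where
  "is_line G w s m C \<longleftrightarrow>
    maximal_clique G C \<and> int (card C) \<ge> int w + 2 - (int s - 1) * int m"

lemma (in graph) out_degree_eq_card_neighbors: "out_degree G x = card (neighbors G x)"
proof -
  have "head G ` out_arcs G x = neighbors G x"
    by (auto simp: neighbors_def arcs_ends_conv out_arcs_def)
  moreover have "inj_on (head G) (out_arcs G x)"
    by (rule inj_onI) (auto intro: no_multi_arcs simp: arc_to_ends_def)
  ultimately show ?thesis
    unfolding out_degree_def by (metis card_image)
qed

lemma pair_graph_K_tilde: "pair_graph (K_tilde a b)"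
proof
  have "parcs (K_tilde a b) \<subseteq> pverts (K_tilde a b) \<times> pverts (K_tilde a b)"
    by (auto simp: K_tilde_def)
  then show "finite (parcs (K_tilde a b))"
    by (rule finite_subset) (simp add: K_tilde_def)
qed (auto simp: K_tilde_def symmetric_def sym_def)

lemma card_pverts_K_tilde: "card (pverts (K_tilde a b)) = a + b + 1"
  by (simp add: K_tilde_def card_image)

end

theory Submission
  imports Defs
begin

text \<open>
  The lines through a vertex \<open>x\<close>, with \<open>x\<close> removed, are the large maximal cliques of the local
  graph at \<open>x\<close> (\<open>is_line_iff_local\<close>). So the theorem says that the large maximal cliques of a local
  graph partition its vertices, and that there are at most \<open>s\<close> of them. A local graph is
  \<open>w\<close>-regular, any two of its non-adjacent vertices have at most \<open>e\<close> common neighbors in it, and it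
  has fewer than \<open>(s + 1) (w + 1) - (s + 1 choose 2) e\<close> vertices. By Bonferroni's inequality it has
  no \<open>s + 1\<close> pairwise non-adjacent vertices (\<open>coclique_card_le\<close>).

  What the forbidden subgraph gives is a dichotomy (\<open>few_neighbors_in_local_clique\<close>): a vertex is
  adjacent to every other vertex of a clique with more than \<open>m s\<close> vertices, or to at most \<open>m\<close> of its
  vertices. Indeed, if \<open>y\<close> misses a vertex \<open>c\<close> of the clique, then its neighbors in the clique are
  common neighbors of \<open>y\<close> and \<open>c\<close>, so there are at most \<open>e\<close>, and since \<open>m s + 1 \<ge> e + n\<close> there are
  at least \<open>n\<close> non-neighbors. With \<open>m + 1\<close> neighbors there would be a forbidden subgraph.

  To find the large cliques, take a maximum coclique \<open>S\<close>. For \<open>i \<in> S\<close>, the vertices of the closed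
  neighborhood of \<open>i\<close> that lie in no other closed neighborhood around \<open>S\<close> form a clique, since two
  non-adjacent ones could replace \<open>i\<close> in \<open>S\<close>. There are at least \<open>w + 1 - (s - 1) e > m s\<close> of them, and
  by the dichotomy this clique lies in a unique maximal clique \<open>L\<^sub>i\<close>. The cliques \<open>L\<^sub>i\<close> cover the local
  graph (\<open>completions_cover\<close>): a vertex outside all of them could be extended greedily by one vertex
  for each \<open>i \<in> S\<close> to a coclique larger than \<open>S\<close>, because each vertex already chosen excludes at most
  \<open>m\<close> of the more than \<open>m s\<close> candidates. As \<open>i\<close> has at most \<open>m\<close> neighbors in each of the other
  cliques, the covering shows that \<open>L\<^sub>i\<close> has at least \<open>w + 1 - (s - 1) m\<close> vertices. Finally, two
  different maximal cliques of this size cannot share a vertex \<open>y\<close>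
  (\<open>large_maximal_unique\<close>): they meet in at most \<open>m\<close> vertices, and their union does not fit into the
  closed neighborhood of \<open>y\<close>. So the \<open>L\<^sub>i\<close> are all the large maximal cliques.
\<close>

section \<open>Large cliques in graphs without large cocliques\<close>

text \<open>
  The properties of a local graph that the counting arguments use. The assumption
  \<open>few_neighbors_in_clique\<close> is the only trace of the forbidden subgraph.
\<close>

locale clique_cover =
  fixes V :: "'a set" and adj :: "'a \<Rightarrow> 'a \<Rightarrow> bool" and s m e w :: nat
  assumes finite_V: "finite V"
    and adj_sym: "adj x y \<Longrightarrow> adj y x"
    and adj_irrefl: "\<not> adj x x"
    and degree: "x \<in> V \<Longrightarrow> card {y \<in> V. adj x y} = w"
    and common_le: "\<lbrakk>x \<in> V; y \<in> V; x \<noteq> y; \<not> adj x y\<rbrakk> \<Longrightarrow> card {z \<in> V. adj x z \<and> adj y z} \<le> e"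
    and few_vertices: "card V + e * (Suc s choose 2) < Suc s * Suc w"
    and few_neighbors_in_clique:
      "\<lbrakk>K \<subseteq> V; pairwise adj K; card K > m * s; y \<in> V; c \<in> K; y \<noteq> c; \<not> adj y c\<rbrakk>
        \<Longrightarrow> card {z \<in> K. adj y z} \<le> m"
    and degree_ge: "w \<ge> (s - 1) * e + m * s"
    and s_pos: "s > 0"
    and m_le_e: "m \<le> e"
begin

definition closed_nbhd :: "'a \<Rightarrow> 'a set" where
  "closed_nbhd x = {y \<in> V. y = x \<or> adj x y}"

definition coclique :: "'a set \<Rightarrow> bool" where
  "coclique S \<longleftrightarrow> S \<subseteq> V \<and> pairwise (\<lambda>x y. \<not> adj x y) S"

definition is_clique :: "'a set \<Rightarrow> bool" where
  "is_clique K \<longleftrightarrow> K \<subseteq> V \<and> pairwise adj K"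

text \<open>
  For a clique \<open>K\<close> with more than \<open>m s\<close> vertices this is the unique maximal clique that contains
  \<open>K\<close>. The condition \<open>completion L = L\<close> expresses that a clique \<open>L\<close> is maximal.
\<close>

definition completion :: "'a set \<Rightarrow> 'a set" where
  "completion K = {v \<in> V. \<forall>c \<in> K. v = c \<or> adj v c}"

text \<open>
  The size bound of a line, lowered by one for the vertex whose local graph is considered.
\<close>

definition large_maximal :: "'a set \<Rightarrow> bool" where
  "large_maximal L \<longleftrightarrow> is_clique L \<and> completion L = L \<and> card L + (s - 1) * m \<ge> w + 1"

lemma finite_sub: "A \<subseteq> V \<Longrightarrow> finite A"
  by (rule finite_subset[OF _ finite_V])

lemma adj_commute: "adj x y \<longleftrightarrow> adj y x"
  using adj_sym[of x y] adj_sym[of y x] by blast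

lemma card_closed_nbhd:
  assumes "x \<in> V"
  shows "card (closed_nbhd x) = Suc w"
proof -
  have "closed_nbhd x = insert x {y \<in> V. adj x y}"
    using assms by (auto simp: closed_nbhd_def)
  then show ?thesis
    using degree[OF assms] finite_V adj_irrefl by simp
qed

lemma closed_nbhd_Int_le:
  assumes "x \<in> V" "y \<in> V" "x \<noteq> y" "\<not> adj x y"
  shows "card (closed_nbhd x \<inter> closed_nbhd y) \<le> e"
proof -
  have "closed_nbhd x \<inter> closed_nbhd y = {z \<in> V. adj x z \<and> adj y z}"
    using assms adj_sym by (auto simp: closed_nbhd_def)
  then show ?thesis
    using common_le[OF assms] by simp
qed

text \<open>
  Bonferroni's inequality for the closed neighborhoods of a coclique, any two of which share at most
  \<open>e\<close> vertices.
\<close>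

lemma card_UN_closed_nbhd_ge:
  assumes "finite S" "coclique S"
  shows "card S * Suc w \<le> card (\<Union>x\<in>S. closed_nbhd x) + e * (card S choose 2)"
  using assms
proof (induction S)
  case empty
  then show ?case by simp
next
  case (insert x S)
  let ?U = "\<Union>y\<in>S. closed_nbhd y"
  have S: "coclique S" and x: "x \<in> V" and SV: "S \<subseteq> V"
    and nadj: "\<And>y. y \<in> S \<Longrightarrow> x \<noteq> y \<and> \<not> adj x y"
    using insert.prems insert.hyps by (auto simp: coclique_def pairwise_insert)
  have fin: "finite (closed_nbhd y)" for y
    using finite_V by (simp add: closed_nbhd_def)
  have "card (closed_nbhd x \<inter> ?U) \<le> card (\<Union>y\<in>S. closed_nbhd x \<inter> closed_nbhd y)"
    by (rule card_mono) (use insert.hyps fin in auto)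
  also have "\<dots> \<le> (\<Sum>y\<in>S. card (closed_nbhd x \<inter> closed_nbhd y))"
    by (rule card_UN_le) (rule insert.hyps)
  also have "\<dots> \<le> (\<Sum>y\<in>S. e)"
    by (rule sum_mono) (use closed_nbhd_Int_le x SV nadj in blast)
  finally have int: "card (closed_nbhd x \<inter> ?U) \<le> card S * e"
    by simp
  have "card (closed_nbhd x) + card ?U = card (closed_nbhd x \<union> ?U) + card (closed_nbhd x \<inter> ?U)"
    by (rule card_Un_Int) (use insert.hyps fin in auto)
  then have "Suc w + card ?U \<le> card (closed_nbhd x \<union> ?U) + card S * e"
    using int card_closed_nbhd[OF x] by simp
  moreover have "card S * Suc w \<le> card ?U + e * (card S choose 2)"
    using insert.IH S by blast
  ultimately show ?case
    using insert.hyps by (simp add: numeral_2_eq_2 algebra_simps)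
qed

lemma coclique_card_le:
  assumes "coclique S"
  shows "card S \<le> s"
proof (rule ccontr)
  assume "\<not> card S \<le> s"
  then obtain T where T: "T \<subseteq> S" "card T = Suc s"
    using obtain_subset_with_card_n[of "Suc s" S] by auto
  then have cT: "coclique T"
    using assms by (auto simp: coclique_def intro: pairwise_subset)
  then have "finite T"
    using finite_sub by (auto simp: coclique_def)
  then have "Suc s * Suc w \<le> card (\<Union>x\<in>T. closed_nbhd x) + e * (Suc s choose 2)"
    using card_UN_closed_nbhd_ge cT T by metis
  moreover have "card (\<Union>x\<in>T. closed_nbhd x) \<le> card V"
    by (rule card_mono[OF finite_V]) (auto simp: closed_nbhd_def)
  ultimately show False
    using few_vertices by linarith
qed

lemma is_clique_subset_completion:
  assumes "is_clique D" "K \<subseteq> D"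
  shows "D \<subseteq> completion K"
  using assms unfolding is_clique_def completion_def pairwise_def by blast

lemma is_clique_insert:
  assumes "is_clique K" "v \<in> completion K"
  shows "is_clique (insert v K)"
  using assms adj_sym by (auto simp: is_clique_def completion_def pairwise_insert)

lemma card_nbrs_clique_le:
  assumes "is_clique K" "card K > m * s" "y \<in> V - completion K"
  shows "card {z \<in> K. adj y z} \<le> m"
proof -
  obtain c where "c \<in> K" "y \<noteq> c" "\<not> adj y c"
    using assms(3) by (auto simp: completion_def)
  then show ?thesis
    using few_neighbors_in_clique[of K y c] assms by (simp add: is_clique_def)
qed

text \<open>
  If \<open>u\<close> and \<open>v\<close> are non-adjacent, then \<open>v\<close> misses a vertex of the clique \<open>insert u K\<close>. So it has at
  most \<open>m\<close> neighbors there, and it cannot be adjacent to all of \<open>K\<close>.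
\<close>

lemma is_clique_completion:
  assumes K: "is_clique K" "card K > m * s"
  shows "is_clique (completion K)"
  unfolding is_clique_def
proof
  show "completion K \<subseteq> V" by (auto simp: completion_def)
  show "pairwise adj (completion K)"
  proof (rule pairwiseI, rule ccontr)
    fix u v assume uv: "u \<in> completion K" "v \<in> completion K" "u \<noteq> v" "\<not> adj u v"
    have KV: "K \<subseteq> V" and finK: "finite K"
      using K finite_sub by (auto simp: is_clique_def)
    have "is_clique (insert u K)"
      using is_clique_insert K uv by blast
    moreover have "card K \<le> card (insert u K)"
      using finK by (simp add: card_insert_le)
    moreover have "v \<in> V - completion (insert u K)"
      using uv adj_sym by (auto simp: completion_def)
    ultimately have "card {z \<in> insert u K. adj v z} \<le> m"
      using card_nbrs_clique_le[of "insert u K" v] K(2) by linarith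
    moreover have "v \<notin> K"
      using uv by (auto simp: completion_def)
    then have "K \<subseteq> {z \<in> insert u K. adj v z}"
      using uv by (auto simp: completion_def)
    then have "card K \<le> card {z \<in> insert u K. adj v z}"
      using finK by (intro card_mono) auto
    moreover have "m \<le> m * s"
      using s_pos by simp
    ultimately show False
      using K by linarith
  qed
qed

lemma completion_completion:
  assumes "is_clique K" "card K > m * s"
  shows "completion (completion K) = completion K"
  using is_clique_subset_completion[OF is_clique_completion[OF assms] order_refl]
    is_clique_subset_completion[OF assms(1) order_refl]
  by (auto simp: completion_def)

lemma card_completion_gt:
  assumes "is_clique K" "card K > m * s"
  shows "card (completion K) > m * s"
proof -
  have "card K \<le> card (completion K)"
    using is_clique_subset_completion[OF assms(1) order_refl] finite_V by (intro card_mono) (auto simp: completion_def)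
  then show ?thesis using assms by linarith
qed

lemma card_nbrs_completion_le:
  assumes "is_clique K" "card K > m * s" "y \<in> V - completion K"
  shows "card {z \<in> completion K. adj y z} \<le> m"
  using card_nbrs_clique_le[OF is_clique_completion[OF assms(1,2)] card_completion_gt[OF assms(1,2)]]
    completion_completion[OF assms(1,2)] assms(3)
  by simp

lemma large_maximal_card_gt:
  assumes "large_maximal L"
  shows "card L > m * s"
proof -
  have "(s - 1) * m \<le> (s - 1) * e"
    using m_le_e by simp
  then show ?thesis
    using assms degree_ge unfolding large_maximal_def by linarith
qed

text \<open>
  A vertex of \<open>L'\<close> outside \<open>L\<close> is adjacent to all of \<open>L \<inter> L'\<close>, so this intersection has at most \<open>m\<close>
  vertices. Then \<open>L \<union> L'\<close> has at least \<open>2 (w + 1 - (s - 1) m) - m\<close> vertices, which exceeds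
  \<open>w + 1\<close> because \<open>w \<ge> (s - 1) e + m s \<ge> (2 s - 1) m\<close>.
\<close>

lemma large_maximal_unique:
  assumes L: "large_maximal L" and L': "large_maximal L'" and y: "y \<in> L" "y \<in> L'"
  shows "L = L'"
proof (rule ccontr)
  assume neq: "L \<noteq> L'"
  have is_clique: "is_clique L" "is_clique L'" and completion: "completion L = L" "completion L' = L'"
    using L L' by (auto simp: large_maximal_def)
  have fin: "finite L" "finite L'"
    using is_clique finite_sub by (auto simp: is_clique_def)
  have "\<not> L' \<subseteq> L"
  proof
    assume sub: "L' \<subseteq> L"
    have "L \<subseteq> completion L'"
      using sub is_clique by (auto simp: completion_def is_clique_def pairwise_def)
    then show False using completion neq sub by auto
  qed
  then obtain u where u: "u \<in> L'" "u \<notin> L" by auto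
  then have "u \<in> V - completion L"
    using is_clique completion by (auto simp: is_clique_def)
  then have "card {z \<in> L. adj u z} \<le> m"
    using card_nbrs_clique_le is_clique large_maximal_card_gt L by blast
  moreover have "L \<inter> L' \<subseteq> {z \<in> L. adj u z}"
    using u is_clique by (auto simp: is_clique_def pairwise_def)
  then have "card (L \<inter> L') \<le> card {z \<in> L. adj u z}"
    using fin by (intro card_mono) auto
  ultimately have int: "card (L \<inter> L') \<le> m" by linarith
  have "L \<union> L' \<subseteq> closed_nbhd y"
    using y is_clique by (auto simp: is_clique_def closed_nbhd_def pairwise_def)
  then have "card (L \<union> L') \<le> card (closed_nbhd y)"
    using finite_V by (intro card_mono) (auto simp: closed_nbhd_def)
  then have un: "card (L \<union> L') \<le> Suc w"
    using card_closed_nbhd y is_clique by (auto simp: is_clique_def)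
  have "card L + card L' \<le> Suc w + m"
    using card_Un_Int[OF fin] int un by linarith
  moreover have "card L + (s - 1) * m \<ge> w + 1" "card L' + (s - 1) * m \<ge> w + 1"
    using L L' by (auto simp: large_maximal_def)
  moreover have "(s - 1) * m \<le> (s - 1) * e"
    using m_le_e by simp
  moreover have "m * s = (s - 1) * m + m"
    using s_pos by (cases s) auto
  ultimately show False
    using degree_ge by linarith
qed

definition private_nbhd :: "'a set \<Rightarrow> 'a \<Rightarrow> 'a set" where
  "private_nbhd S i = closed_nbhd i - (\<Union>j\<in>S - {i}. closed_nbhd j)"

definition maximum_coclique :: "'a set \<Rightarrow> bool" where
  "maximum_coclique S \<longleftrightarrow> coclique S \<and> (\<forall>T. coclique T \<longrightarrow> card T \<le> card S)"

lemma ex_maximum_coclique: "\<exists>S. maximum_coclique S"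
proof -
  have "coclique {}" by (simp add: coclique_def)
  moreover have "\<forall>T. coclique T \<longrightarrow> card T \<le> s"
    using coclique_card_le by blast
  ultimately show ?thesis
    unfolding maximum_coclique_def
    using ex_has_greatest_nat[of coclique "{}" card "Suc s"] by (simp add: less_Suc_eq_le)
qed

lemma mem_private_nbhd_self:
  assumes "coclique S" "i \<in> S"
  shows "i \<in> private_nbhd S i"
proof -
  have "i \<in> V" and "\<And>j. j \<in> S - {i} \<Longrightarrow> i \<noteq> j \<and> \<not> adj j i"
    using assms unfolding coclique_def pairwise_def by blast+
  then show ?thesis
    by (auto simp: private_nbhd_def closed_nbhd_def)
qed

text \<open>
  If \<open>u\<close> and \<open>v\<close> were non-adjacent, then replacing \<open>i\<close> by both of them would enlarge the
  coclique \<open>S\<close>.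
\<close>

lemma is_clique_private_nbhd:
  assumes S: "maximum_coclique S" and i: "i \<in> S"
  shows "is_clique (private_nbhd S i)"
  unfolding is_clique_def
proof
  show "private_nbhd S i \<subseteq> V"
    by (auto simp: private_nbhd_def closed_nbhd_def)
  show "pairwise adj (private_nbhd S i)"
  proof (rule pairwiseI, rule ccontr)
    fix u v assume u: "u \<in> private_nbhd S i" and v: "v \<in> private_nbhd S i"
      and uv: "u \<noteq> v" "\<not> adj u v"
    have cS: "coclique S" and fS: "finite S"
      using S finite_sub by (auto simp: coclique_def maximum_coclique_def)
    have new: "u \<notin> S - {i}" "v \<notin> S - {i}" "u \<in> V" "v \<in> V"
      using u v by (auto simp: private_nbhd_def closed_nbhd_def)
    have nonadj: "\<not> adj j u \<and> \<not> adj j v" if "j \<in> S - {i}" for j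
      using u v that by (auto simp: private_nbhd_def closed_nbhd_def)
    have "coclique (insert u (insert v (S - {i})))"
      using cS uv new nonadj adj_commute
      unfolding coclique_def pairwise_def by blast
    then have "card (insert u (insert v (S - {i}))) \<le> card S"
      using S by (auto simp: maximum_coclique_def)
    moreover have "card (insert u (insert v (S - {i}))) = Suc (card S)"
      using fS uv new card.remove[OF fS i] by simp
    ultimately show False by simp
  qed
qed

text \<open>
  At most \<open>e\<close> of the \<open>w + 1\<close> vertices of the closed neighborhood of \<open>i\<close> are lost to each of the at
  most \<open>s - 1\<close> other members of \<open>S\<close>.
\<close>

lemma card_private_nbhd_gt:
  assumes "coclique S" "i \<in> S"
  shows "card (private_nbhd S i) > m * s"
proof -
  have fS: "finite S" and SV: "S \<subseteq> V"
    using assms finite_sub by (auto simp: coclique_def)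
  have fin: "finite (closed_nbhd j)" for j
    using finite_V by (simp add: closed_nbhd_def)
  let ?B = "\<Union>j\<in>S - {i}. closed_nbhd i \<inter> closed_nbhd j"
  have "card ?B \<le> (\<Sum>j\<in>S - {i}. card (closed_nbhd i \<inter> closed_nbhd j))"
    by (rule card_UN_le) (use fS in simp)
  also have "\<dots> \<le> (\<Sum>j\<in>S - {i}. e)"
    by (rule sum_mono, rule closed_nbhd_Int_le)
      (use assms SV in \<open>auto simp: coclique_def pairwise_def\<close>)
  also have "\<dots> = (card S - 1) * e"
    using assms fS by simp
  also have "\<dots> \<le> (s - 1) * e"
    using coclique_card_le[OF assms(1)] by (intro mult_right_mono) auto
  finally have B: "card ?B \<le> (s - 1) * e" .
  have "closed_nbhd i \<subseteq> private_nbhd S i \<union> ?B"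
    by (auto simp: private_nbhd_def)
  then have "card (closed_nbhd i) \<le> card (private_nbhd S i \<union> ?B)"
    using fin fS by (intro card_mono) (auto simp: private_nbhd_def)
  also have "\<dots> \<le> card (private_nbhd S i) + card ?B"
    by (rule card_Un_le)
  finally have "Suc w \<le> card (private_nbhd S i) + (s - 1) * e"
    using B card_closed_nbhd[of i] SV assms by auto
  then show ?thesis
    using degree_ge by linarith
qed

lemma private_nbhd_not_in_completion:
  assumes "coclique S" "i \<in> S" "j \<in> S" "i \<noteq> j" "v \<in> private_nbhd S i"
  shows "v \<in> V - completion (private_nbhd S j)"
proof -
  have "v \<notin> closed_nbhd j" "v \<in> V"
    using assms by (auto simp: private_nbhd_def closed_nbhd_def)
  then show ?thesis
    using mem_private_nbhd_self[of S j] assms adj_sym by (auto simp: completion_def closed_nbhd_def)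
qed

text \<open>
  The coclique grows from \<open>{y}\<close> by one vertex of each private neighborhood. When the turn of \<open>j\<close>
  comes, every vertex chosen so far lies outside the completion of the private neighborhood of \<open>j\<close>, so
  it is adjacent to at most \<open>m\<close> of the more than \<open>m s\<close> candidates. At most \<open>s\<close> vertices have been
  chosen, hence a candidate remains.
\<close>

lemma greedy_coclique:
  assumes S: "maximum_coclique S"
    and y: "y \<in> V" "\<And>j. j \<in> S \<Longrightarrow> y \<notin> completion (private_nbhd S j)"
    and J: "J \<subseteq> S"
  shows "\<exists>Z. coclique Z \<and> card Z = Suc (card J) \<and> Z \<subseteq> insert y (\<Union>j\<in>J. private_nbhd S j)"
proof -
  have cS: "coclique S" using S by (simp add: maximum_coclique_def)
  then have fS: "finite S" using finite_sub by (auto simp: coclique_def)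
  have "finite J" using J fS finite_subset by blast
  then show ?thesis
    using J
  proof (induction J)
    case empty
    then show ?case using y by (intro exI[of _ "{y}"]) (simp add: coclique_def)
  next
    case (insert j J)
    then obtain Z where Z: "coclique Z" "card Z = Suc (card J)"
        "Z \<subseteq> insert y (\<Union>j\<in>J. private_nbhd S j)"
      by auto
    have fZ: "finite Z" using Z finite_sub by (auto simp: coclique_def)
    let ?K = "private_nbhd S j"
    have K: "is_clique ?K" "card ?K > m * s"
      using is_clique_private_nbhd[OF S] card_private_nbhd_gt[OF cS] insert.prems by auto
    have outside: "z \<in> V - completion ?K" if z: "z \<in> Z" for z
    proof (cases "z = y")
      case True
      then show ?thesis using y insert.prems by auto
    next
      case False
      then obtain i where "i \<in> J" "z \<in> private_nbhd S i" using Z(3) z by blast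
      then show ?thesis
        using private_nbhd_not_in_completion[OF cS, of i j z] insert.prems insert.hyps by auto
    qed
    have "card (\<Union>z\<in>Z. {v \<in> ?K. adj z v}) \<le> (\<Sum>z\<in>Z. card {v \<in> ?K. adj z v})"
      by (rule card_UN_le[OF fZ])
    also have "\<dots> \<le> (\<Sum>z\<in>Z. m)"
      by (rule sum_mono) (use card_nbrs_clique_le[OF K] outside in blast)
    also have "\<dots> = card Z * m" by simp
    also have "\<dots> \<le> s * m"
    proof (rule mult_right_mono)
      \<comment> \<open>Since \<open>j\<close> itself is still to be served, \<open>card J + 1\<close> is at most \<open>card S\<close>.\<close>
      have "card (insert j J) \<le> card S"
        using insert.prems fS by (intro card_mono)
      then show "card Z \<le> s"
        using Z insert.hyps coclique_card_le[OF cS] by simp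
    qed simp
    finally have "card (\<Union>z\<in>Z. {v \<in> ?K. adj z v}) < card ?K"
      using K by (simp add: mult.commute)
    then have "(\<Union>z\<in>Z. {v \<in> ?K. adj z v}) \<noteq> ?K" by auto
    then obtain v where v: "v \<in> ?K" "\<And>z. z \<in> Z \<Longrightarrow> \<not> adj z v"
      by blast
    have "v \<in> completion ?K" using v is_clique_subset_completion K by blast
    then have new: "v \<notin> Z" "v \<in> V" using outside unfolding completion_def by blast+
    then have "coclique (insert v Z)"
      using Z(1) v(2) adj_commute unfolding coclique_def pairwise_insert by blast
    moreover have "card (insert v Z) = Suc (card (insert j J))"
      using new(1) Z(2) fZ insert.hyps by simp
    moreover have "insert v Z \<subseteq> insert y (\<Union>j\<in>insert j J. private_nbhd S j)"
      using Z v by auto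
    ultimately show ?case by blast
  qed
qed

text \<open>
  A vertex outside every completion would start a greedy coclique with more vertices than the
  maximum coclique \<open>S\<close>.
\<close>

lemma completions_cover:
  assumes "maximum_coclique S" "y \<in> V"
  shows "\<exists>i \<in> S. y \<in> completion (private_nbhd S i)"
proof (rule ccontr)
  assume "\<not> ?thesis"
  then obtain Z where "coclique Z" "card Z = Suc (card S)"
    using greedy_coclique[OF assms, of S] by auto
  then show False
    using assms by (auto simp: maximum_coclique_def)
qed

text \<open>
  The completions cover all \<open>w\<close> neighbors of \<open>i\<close>, and each completion other than that of \<open>i\<close> contains
  at most \<open>m\<close> of them.
\<close>

lemma large_maximal_completion:
  assumes S: "maximum_coclique S" and i: "i \<in> S"
  shows "large_maximal (completion (private_nbhd S i))"
proof -
  have cS: "coclique S" using S by (simp add: maximum_coclique_def)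
  then have fS: "finite S" and SV: "S \<subseteq> V" using finite_sub by (auto simp: coclique_def)
  define H where "H j = completion (private_nbhd S j)" for j
  have fH: "finite (H j)" for j using finite_V by (simp add: H_def completion_def)
  have K: "is_clique (private_nbhd S j)" "card (private_nbhd S j) > m * s" if "j \<in> S" for j
    using is_clique_private_nbhd[OF S] card_private_nbhd_gt[OF cS] that by auto
  let ?B = "\<Union>j\<in>S - {i}. {z \<in> H j. adj i z}"
  have iH: "i \<in> H i"
    using mem_private_nbhd_self[OF cS i] is_clique_subset_completion K i by (auto simp: H_def)
  have "card {z \<in> H j. adj i z} \<le> m" if "j \<in> S - {i}" for j
    unfolding H_def
    using card_nbrs_completion_le[OF K] private_nbhd_not_in_completion[OF cS i] mem_private_nbhd_self[OF cS i] that
    by auto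
  then have "(\<Sum>j\<in>S - {i}. card {z \<in> H j. adj i z}) \<le> (\<Sum>j\<in>S - {i}. m)"
    by (rule sum_mono)
  moreover have "card ?B \<le> (\<Sum>j\<in>S - {i}. card {z \<in> H j. adj i z})"
    by (rule card_UN_le) (use fS in simp)
  moreover have "(\<Sum>j\<in>S - {i}. m) = (card S - 1) * m"
    using i fS by simp
  moreover have "(card S - 1) * m \<le> (s - 1) * m"
    using coclique_card_le[OF cS] by (intro mult_right_mono) auto
  ultimately have B: "card ?B \<le> (s - 1) * m" by linarith
  have "closed_nbhd i \<subseteq> H i \<union> ?B"
  proof
    fix z assume z: "z \<in> closed_nbhd i"
    then obtain j where "j \<in> S" "z \<in> H j"
      using completions_cover[OF S] by (auto simp: closed_nbhd_def H_def)
    then show "z \<in> H i \<union> ?B"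
      using z iH by (auto simp: closed_nbhd_def)
  qed
  then have "card (closed_nbhd i) \<le> card (H i \<union> ?B)"
    using fH fS by (intro card_mono) auto
  also have "\<dots> \<le> card (H i) + card ?B"
    by (rule card_Un_le)
  finally have "w + 1 \<le> card (H i) + (s - 1) * m"
    using B card_closed_nbhd i SV by auto
  then show ?thesis
    using is_clique_completion[OF K[OF i]] completion_completion[OF K[OF i]] by (simp add: large_maximal_def H_def)
qed

lemma ex1_large_maximal:
  assumes "y \<in> V"
  shows "\<exists>!L. large_maximal L \<and> y \<in> L"
proof -
  obtain S where "maximum_coclique S" using ex_maximum_coclique by blast
  then have "\<exists>L. large_maximal L \<and> y \<in> L"
    using completions_cover[OF _ assms] large_maximal_completion by blast
  then show ?thesis using large_maximal_unique by blast
qed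

lemma card_large_maximal_le: "finite {L. large_maximal L}" "card {L. large_maximal L} \<le> s"
proof -
  obtain S where S: "maximum_coclique S" using ex_maximum_coclique by blast
  then have cS: "coclique S" by (simp add: maximum_coclique_def)
  then have fS: "finite S" using finite_sub by (auto simp: coclique_def)
  have sub: "{L. large_maximal L} \<subseteq> (\<lambda>i. completion (private_nbhd S i)) ` S"
  proof
    fix L assume "L \<in> {L. large_maximal L}"
    then have L: "large_maximal L" by simp
    then have "L \<noteq> {}" using large_maximal_card_gt[OF L] by auto
    then obtain y where y: "y \<in> L" by auto
    then have "y \<in> V" using L by (auto simp: large_maximal_def is_clique_def)
    then obtain i where "i \<in> S" "y \<in> completion (private_nbhd S i)" using completions_cover[OF S] by auto
    then show "L \<in> (\<lambda>i. completion (private_nbhd S i)) ` S"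
      using large_maximal_unique[OF L large_maximal_completion[OF S] y] by (intro image_eqI)
  qed
  then show "finite {L. large_maximal L}"
    by (rule finite_surj[OF fS])
  have "card {L. large_maximal L} \<le> card S"
    using surj_card_le[OF fS sub] .
  then show "card {L. large_maximal L} \<le> s"
    using coclique_card_le[OF cS] by linarith
qed

end

section \<open>The forbidden subgraph in a local graph\<close>

text \<open>
  Without parallel arcs, an arc can be renamed to its pair of end points, so an injective renaming of
  the vertices is enough for an isomorphism onto a graph whose arcs are pairs.
\<close>

lemma (in nomulti_digraph) digraph_iso_relabel:
  assumes "inj_on f (verts G)"
  shows "digraph_iso G
    (with_proj \<lparr> pverts = f ` verts G, parcs = map_prod f f ` arcs_ends G \<rparr>)"
proof -
  let ?hom = "\<lparr> iso_verts = f, iso_arcs = \<lambda>a. (f (tail G a), f (head G a)),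
    iso_head = snd, iso_tail = fst \<rparr>"
  have "inj_on (\<lambda>a. (f (tail G a), f (head G a))) (arcs G)"
  proof (rule inj_onI)
    fix a b assume "a \<in> arcs G" "b \<in> arcs G" "(f (tail G a), f (head G a)) = (f (tail G b), f (head G b))"
    then show "a = b"
      using assms by (intro no_multi_arcs) (auto simp: arc_to_ends_def dest: inj_onD)
  qed
  then have "digraph_isomorphism ?hom"
    using assms wf_digraph by (simp add: digraph_isomorphism_def)
  moreover have "with_proj \<lparr> pverts = f ` verts G, parcs = map_prod f f ` arcs_ends G \<rparr> = app_iso ?hom G"
    by (simp add: with_proj_def app_iso_def arcs_ends_conv image_image)
  ultimately show ?thesis
    unfolding digraph_iso_def by blast
qed

lemma (in wf_digraph) dominates_induce_iff:
  "u \<rightarrow>\<^bsub>G \<restriction> W\<^esub> v \<longleftrightarrow> u \<in> W \<and> v \<in> W \<and> u \<rightarrow> v"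
  by (auto simp: arcs_ends_conv)

lemma (in graph) dominates_sym: "u \<rightarrow> v \<Longrightarrow> v \<rightarrow> u"
  using arcs_ends_symmetric[OF sym_arcs] .

text \<open>
  The forbidden subgraph is spanned by \<open>y\<close>, in the role of \<open>\<infinity>\<close>, together with its neighbors \<open>A\<close> and
  its non-neighbors \<open>B\<close> in a clique. The isomorphism has to number \<open>A\<close> first, because \<^const>\<open>K_tilde\<close>
  joins \<open>\<infinity>\<close> to the initial numbers.
\<close>

lemma (in graph) not_K_tilde_freeI:
  assumes X: "X \<subseteq> verts G" and y: "y \<in> X" "y \<notin> A" "y \<notin> B"
    and AB: "A \<subseteq> X" "B \<subseteq> X" "A \<inter> B = {}" "card A = a" "card B = b"
    and clique: "clique G (A \<union> B)"
    and adj: "\<And>z. z \<in> A \<Longrightarrow> y \<rightarrow> z" and nonadj: "\<And>z. z \<in> B \<Longrightarrow> \<not> y \<rightarrow> z"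
  shows "\<not> K_tilde_free a b (G \<restriction> X)"
proof -
  have fin: "finite A" "finite B"
    using AB X finite_verts finite_subset by metis+
  obtain g where g: "bij_betw g A {..<a}"
    using finite_same_card_bij[OF fin(1), of "{..<a}"] AB by auto
  obtain h where h: "bij_betw h B {a..<a + b}"
    using finite_same_card_bij[OF fin(2), of "{a..<a + b}"] AB by auto
  define f where "f v = (if v = y then None else if v \<in> A then Some (g v) else Some (h v))" for v
  let ?W = "insert y (A \<union> B)"
  have f_y: "f y = None"
    by (simp add: f_def)
  have f_A: "f ` A = Some ` {..<a}"
  proof -
    have "f ` A = Some ` g ` A"
      unfolding image_image by (rule image_cong) (use y in \<open>auto simp: f_def\<close>)
    then show ?thesis using g by (simp add: bij_betw_def)
  qed
  have f_B: "f ` B = Some ` {a..<a + b}"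
  proof -
    have "f ` B = Some ` h ` B"
      unfolding image_image by (rule image_cong) (use y AB in \<open>auto simp: f_def\<close>)
    then show ?thesis using h by (simp add: bij_betw_def)
  qed
  have f_AB: "f ` (A \<union> B) = Some ` {..<a + b}"
    by (simp flip: image_Un add: image_Un[of f] f_A f_B ivl_disj_un)
  have inj_AB: "inj_on f (A \<union> B)"
    by (rule eq_card_imp_inj_on) (use AB fin in \<open>simp_all add: f_AB card_image card_Un_disjoint\<close>)
  have inj: "inj_on f ?W"
    using inj_AB f_AB f_y by (auto simp: inj_on_insert)
  have ends: "arcs_ends (G \<restriction> ?W) =
      {(u, v). u \<in> A \<union> B \<and> v \<in> A \<union> B \<and> u \<noteq> v} \<union> {y} \<times> A \<union> A \<times> {y}" (is "_ = ?D \<union> _ \<union> _")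
  proof -
    have "u \<rightarrow> v" if "u \<in> A \<union> B" "v \<in> A \<union> B" "u \<noteq> v" for u v
      using clique that unfolding clique_def by blast
    then have "u \<rightarrow>\<^bsub>G \<restriction> ?W\<^esub> v \<longleftrightarrow> (u, v) \<in> ?D \<union> {y} \<times> A \<union> A \<times> {y}" for u v
      unfolding dominates_induce_iff using y adj nonadj adj_not_same dominates_sym by blast
    then show ?thesis
      by (intro equalityI subrelI) blast+
  qed
  have "map_prod f f ` ?D = {(Some i, Some j) | i j. i < a + b \<and> j < a + b \<and> i \<noteq> j}" (is "_ = ?E")
  proof
    show "map_prod f f ` ?D \<subseteq> ?E"
    proof (rule image_subsetI)
      fix p assume "p \<in> ?D"
      then obtain u v where p: "p = (u, v)" and "u \<in> A \<union> B" "v \<in> A \<union> B" "u \<noteq> v"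
        by blast
      then have "f u \<in> Some ` {..<a + b}" "f v \<in> Some ` {..<a + b}" "f u \<noteq> f v"
        using f_AB inj_onD[OF inj_AB] by blast+
      then show "map_prod f f p \<in> ?E" by (auto simp: p)
    qed
    show "?E \<subseteq> map_prod f f ` ?D"
    proof
      fix p assume "p \<in> ?E"
      then obtain i j where p: "p = (Some i, Some j)" and ij: "i < a + b" "j < a + b" "i \<noteq> j"
        by blast
      then have "Some i \<in> f ` (A \<union> B)" "Some j \<in> f ` (A \<union> B)"
        unfolding f_AB by auto
      then obtain u v where uv: "u \<in> A \<union> B" "v \<in> A \<union> B" "Some i = f u" "Some j = f v"
        by blast
      have "u \<noteq> v"
        using uv ij by (metis option.inject)
      then have "(u, v) \<in> ?D"
        using uv by blast
      then show "p \<in> map_prod f f ` ?D"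
        using uv p by (intro image_eqI[of _ _ "(u, v)"]) simp_all
    qed
  qed
  moreover have "map_prod f f ` ({y} \<times> A) = {(None, Some i) | i. i < a}"
  proof -
    have "map_prod f f ` ({y} \<times> A) = {f y} \<times> f ` A"
      by force
    then show ?thesis unfolding f_A f_y by auto
  qed
  moreover have "map_prod f f ` (A \<times> {y}) = {(Some i, None) | i. i < a}"
  proof -
    have "map_prod f f ` (A \<times> {y}) = f ` A \<times> {f y}"
      by force
    then show ?thesis unfolding f_A f_y by auto
  qed
  ultimately have "map_prod f f ` arcs_ends (G \<restriction> ?W) = parcs (K_tilde a b)"
    unfolding ends image_Un K_tilde_def by simp
  moreover have "f ` ?W = pverts (K_tilde a b)"
    by (simp only: image_insert f_AB f_y) (simp add: K_tilde_def)
  ultimately have K: "K_tilde a b = \<lparr> pverts = f ` ?W, parcs = map_prod f f ` arcs_ends (G \<restriction> ?W) \<rparr>"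
    by simp
  have WX: "?W \<subseteq> X" using y AB by auto
  then have "?W \<subseteq> verts G" using X by auto
  then have "digraph (G \<restriction> ?W)"
    using digraph_subgraph induced_imp_subgraph induced_induce by blast
  then interpret W: nomulti_digraph "G \<restriction> ?W"
    by (simp add: digraph_def)
  have "digraph_iso (G \<restriction> ?W) (with_proj (K_tilde a b))"
    unfolding K using W.digraph_iso_relabel[of f] inj by simp
  moreover have "induced_subgraph (G \<restriction> ?W) (G \<restriction> X)"
  proof -
    interpret X: wf_digraph "G \<restriction> X"
      by (rule wellformed_induce_subgraph)
    have "(G \<restriction> X) \<restriction> ?W = G \<restriction> ?W"
      unfolding induce_subgraph_def using WX by auto
    then show ?thesis
      using X.induced_induce[of ?W] WX by simp
  qed
  ultimately show ?thesis
    unfolding K_tilde_free_def by blast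
qed

lemma mem_neighbors: "y \<in> neighbors G x \<longleftrightarrow> x \<rightarrow>\<^bsub>G\<^esub> y"
  by (simp add: neighbors_def)

lemma (in graph) finite_neighbors: "finite (neighbors G x)"
  by (rule finite_subset[OF _ finite_verts]) (auto simp: neighbors_def dest: adj_in_verts)

text \<open>
  The vertex \<open>x\<close> is a common neighbor of \<open>y\<close> and \<open>z\<close> outside its own local graph.
\<close>

lemma (in graph) card_local_common_neighbors_le:
  assumes common: "card (common_neighbors G y z) \<le> e + 1"
    and yz: "y \<in> neighbors G x" "z \<in> neighbors G x"
  shows "card {v \<in> neighbors G x. y \<rightarrow> v \<and> z \<rightarrow> v} \<le> e"
proof -
  let ?C = "{v \<in> neighbors G x. y \<rightarrow> v \<and> z \<rightarrow> v}"
  have "x \<notin> ?C"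
    using adj_not_same by (auto simp: neighbors_def)
  moreover have "finite ?C"
    using finite_neighbors by simp
  ultimately have "Suc (card ?C) = card (insert x ?C)"
    by simp
  also have "\<dots> \<le> card (common_neighbors G y z)"
    using yz dominates_sym finite_neighbors
    by (intro card_mono) (auto simp: common_neighbors_def neighbors_def)
  finally show ?thesis using common by simp
qed

text \<open>
  The neighbors of \<open>y\<close> in \<open>K\<close> are common neighbors of \<open>y\<close> and \<open>c\<close> in the local graph, so there are at
  most \<open>e\<close>, and at least \<open>n\<close> vertices of \<open>K\<close> are not adjacent to \<open>y\<close>. If \<open>y\<close> also had \<open>m + 1\<close>
  neighbors in \<open>K\<close>, it would span a forbidden subgraph with suitable vertices of \<open>K\<close>.
\<close>

lemma (in graph) few_neighbors_in_local_clique: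
  assumes common: "card (common_neighbors G y c) \<le> e + 1"
    and free: "K_tilde_free (m + 1) n (local_graph G x)"
    and K: "K \<subseteq> neighbors G x" "pairwise (dominates G) K" "card K \<ge> e + n"
    and y: "y \<in> neighbors G x" and c: "c \<in> K" "y \<noteq> c" "\<not> y \<rightarrow> c"
  shows "card {z \<in> K. y \<rightarrow> z} \<le> m"
proof (rule ccontr)
  assume many: "\<not> ?thesis"
  have NV: "neighbors G x \<subseteq> verts G"
    by (auto simp: neighbors_def dest: adj_in_verts)
  have fK: "finite K"
    using K finite_neighbors finite_subset by metis
  let ?A = "{z \<in> K. y \<rightarrow> z}" and ?B = "{z \<in> K. \<not> y \<rightarrow> z}"
  have y_notin: "y \<notin> K"
    using K c by (auto simp: pairwise_def)
  have "?A \<subseteq> {v \<in> neighbors G x. y \<rightarrow> v \<and> c \<rightarrow> v}"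
    using K c by (auto simp: pairwise_def)
  then have "card ?A \<le> card {v \<in> neighbors G x. y \<rightarrow> v \<and> c \<rightarrow> v}"
    using finite_neighbors by (intro card_mono) auto
  also have "\<dots> \<le> e"
    by (rule card_local_common_neighbors_le) (use common y c K in auto)
  finally have "card ?A \<le> e" .
  moreover have "card K = card ?A + card ?B"
    using fK by (subst card_Un_disjoint[symmetric]) (auto intro: arg_cong[of _ _ card])
  ultimately have "card ?B \<ge> n"
    using K by linarith
  then obtain B where B: "B \<subseteq> ?B" "card B = n"
    by (meson obtain_subset_with_card_n)
  obtain A where A: "A \<subseteq> ?A" "card A = m + 1"
    using many obtain_subset_with_card_n[of "m + 1" ?A] by auto
  have AB: "A \<union> B \<subseteq> K"
    using A B by auto
  then have "clique G (A \<union> B)"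
    using K NV unfolding clique_def pairwise_def by blast
  then have "\<not> K_tilde_free (m + 1) n (G \<restriction> neighbors G x)"
    by (intro not_K_tilde_freeI[OF NV y _ _ _ _ _ A(2) B(2)]) (use y_notin A B AB K in auto)
  then show False
    using free by (simp add: local_graph_def)
qed

section \<open>Lines through a vertex\<close>

lemma (in graph) local_clique_cover:
  assumes s: "s > 0" and k: "regular k G"
    and w: "\<And>x y. x \<rightarrow> y \<Longrightarrow> card (common_neighbors G x y) = w"
    and e: "\<And>x y. \<lbrakk>x \<in> verts G; y \<in> verts G; x \<noteq> y; \<not> x \<rightarrow> y\<rbrakk>
      \<Longrightarrow> card (common_neighbors G x y) \<le> e + 1"
    and w_ge: "int w > (int s - 1) * int e + int m * int s - 1"
    and k_less: "real k < (real s + 1) * (real w + 1) - real s * (real s + 1) / 2 * real e"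
    and split: "m * s + 1 \<ge> e + n" and "e \<ge> m"
    and free: "K_tilde_free (m + 1) n (local_graph G x)"
    and x: "x \<in> verts G"
  shows "clique_cover (neighbors G x) (dominates G) s m e w"
proof
  let ?N = "neighbors G x"
  have NV: "?N \<subseteq> verts G"
    by (auto simp: neighbors_def dest: adj_in_verts)
  show "finite ?N" by (rule finite_neighbors)
  show "v \<rightarrow> u" if "u \<rightarrow> v" for u v using that by (rule dominates_sym)
  show "\<not> u \<rightarrow> u" for u using adj_not_same by blast
  show "card {z \<in> ?N. y \<rightarrow> z} = w" if "y \<in> ?N" for y
  proof -
    have "{z \<in> ?N. y \<rightarrow> z} = common_neighbors G x y"
      by (auto simp: common_neighbors_def neighbors_def)
    then show ?thesis using w that by (simp add: neighbors_def)
  qed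
  show "card {v \<in> ?N. y \<rightarrow> v \<and> z \<rightarrow> v} \<le> e"
    if "y \<in> ?N" "z \<in> ?N" "y \<noteq> z" "\<not> y \<rightarrow> z" for y z
    by (rule card_local_common_neighbors_le) (use e that NV in auto)
  show "card ?N + e * (Suc s choose 2) < Suc s * Suc w"
  proof -
    have "card ?N = k"
      using k x out_degree_eq_card_neighbors by (metis regular_def)
    moreover have "2 * (Suc s choose 2) = Suc s * s"
      by (simp add: choose_two)
    then have "2 * real (Suc s choose 2) = real s * (real s + 1)"
      by (metis mult.commute of_nat_Suc of_nat_mult of_nat_numeral add.commute)
    then have "real s * (real s + 1) / 2 * real e = real (e * (Suc s choose 2))"
      by simp
    ultimately have "real (card ?N + e * (Suc s choose 2)) < real (Suc s * Suc w)"
      using k_less by (simp add: algebra_simps)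
    then show ?thesis by (simp only: of_nat_less_iff)
  qed
  show "card {z \<in> K. y \<rightarrow> z} \<le> m"
    if "K \<subseteq> ?N" "pairwise (dominates G) K" "m * s < card K" "y \<in> ?N" "c \<in> K" "y \<noteq> c" "\<not> y \<rightarrow> c"
    for K y c
    by (rule few_neighbors_in_local_clique[OF _ free]) (use that e NV split in auto)
  have "int ((s - 1) * e + m * s) \<le> int w"
    using w_ge s by (simp add: of_nat_diff)
  then show "(s - 1) * e + m * s \<le> w" by (simp only: of_nat_le_iff)
qed fact+

text \<open>
  A clique that contains \<open>x\<close> consists of \<open>x\<close> and a clique of the local graph at \<open>x\<close>, so removing
  \<open>x\<close> preserves maximality and lowers the size by one.
\<close>

lemma (in graph) is_line_iff_local:
  assumes cover: "clique_cover (neighbors G x) (dominates G) s m e w" and x: "x \<in> C"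
  shows "is_line G w s m C \<longleftrightarrow>
    clique_cover.large_maximal (neighbors G x) (dominates G) s m w (C - {x})"
proof -
  interpret clique_cover "neighbors G x" "dominates G" s m e w by (rule cover)
  have clique_iff: "clique G D \<longleftrightarrow> is_clique (D - {x})" if xV: "x \<in> verts G" and xD: "x \<in> D" for D
  proof
    assume D: "clique G D"
    then have adj: "u \<rightarrow> v" if "u \<in> D" "v \<in> D" "u \<noteq> v" for u v
      using that by (simp add: clique_def)
    show "is_clique (D - {x})"
      unfolding is_clique_def
    proof (intro conjI subsetI pairwiseI)
      show "v \<in> neighbors G x" if "v \<in> D - {x}" for v
        using adj xD that by (auto simp: mem_neighbors)
    qed (use adj in auto)
  next
    assume D: "is_clique (D - {x})"
    have nbr: "x \<rightarrow> v" if "v \<in> D - {x}" for v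
      using D that by (auto simp: is_clique_def mem_neighbors)
    have adj: "u \<rightarrow> v" if "u \<in> D - {x}" "v \<in> D - {x}" "u \<noteq> v" for u v
      using D that by (simp add: is_clique_def pairwise_def)
    show "clique G D"
      unfolding clique_def
    proof (intro conjI subsetI ballI impI)
      show "v \<in> verts G" if "v \<in> D" for v
        using xV nbr[of v] adj_in_verts that by auto
      show "u \<rightarrow> v" if "u \<in> D" "v \<in> D" "u \<noteq> v" for u v
        using nbr[of u] nbr[of v] adj[of u v] dominates_sym[of x u] that by auto
    qed
  qed
  have maximal_iff: "maximal_clique G C \<longleftrightarrow> is_clique (C - {x}) \<and> completion (C - {x}) = C - {x}"
    if xV: "x \<in> verts G"
  proof
    assume max: "maximal_clique G C"
    then have is_clique: "is_clique (C - {x})"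
      using clique_iff[OF xV x] by (simp add: maximal_clique_def)
    have "v \<in> C - {x}" if v: "v \<in> completion (C - {x})" for v
    proof -
      have "v \<noteq> x"
        using v adj_irrefl by (auto simp: completion_def mem_neighbors)
      then have "insert v C - {x} = insert v (C - {x})"
        by auto
      then have "clique G (insert v C)"
        using clique_iff[OF xV, of "insert v C"] is_clique_insert[OF is_clique v] x by simp
      then have "insert v C = C"
        using max by (auto simp: maximal_clique_def)
      then show ?thesis using \<open>v \<noteq> x\<close> by auto
    qed
    then show "is_clique (C - {x}) \<and> completion (C - {x}) = C - {x}"
      using is_clique is_clique_subset_completion[OF is_clique order_refl] by auto
  next
    assume asm: "is_clique (C - {x}) \<and> completion (C - {x}) = C - {x}"
    have "D = C" if D: "clique G D" "C \<subseteq> D" for D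
    proof -
      have "x \<in> D"
        using D x by auto
      then have "D - {x} \<subseteq> completion (C - {x})"
        using is_clique_subset_completion[of "D - {x}" "C - {x}"] clique_iff[OF xV] D by auto
      then show ?thesis using asm D x by auto
    qed
    then show "maximal_clique G C"
      using asm clique_iff[OF xV x] by (auto simp: maximal_clique_def)
  qed
  have size_iff: "int (card C) \<ge> int w + 2 - (int s - 1) * int m \<longleftrightarrow> card (C - {x}) + (s - 1) * m \<ge> w + 1"
    if "finite C"
  proof -
    have "(int s - 1) * int m = int ((s - 1) * m)"
      using s_pos by (simp add: of_nat_diff)
    moreover have "card C = Suc (card (C - {x}))"
      using card.remove[OF that x] .
    ultimately show ?thesis by linarith
  qed
  show ?thesis
  proof
    assume L: "is_line G w s m C"
    then have "clique G C" by (simp add: is_line_def maximal_clique_def)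
    then have "C \<subseteq> verts G" by (simp add: clique_def)
    then have "finite C" "x \<in> verts G"
      using x finite_subset[OF _ finite_verts] by auto
    then show "large_maximal (C - {x})"
      using L maximal_iff size_iff by (simp add: is_line_def large_maximal_def)
  next
    assume L: "large_maximal (C - {x})"
    then have is_clique: "is_clique (C - {x})" by (simp add: large_maximal_def)
    then have "finite C" using finite_sub[of "C - {x}"] by (simp add: is_clique_def)
    have "C - {x} \<noteq> {}"
      using large_maximal_card_gt[OF L] by (metis card.empty not_less_zero)
    then obtain v where "v \<in> C - {x}" by blast
    then have "x \<rightarrow> v"
      using is_clique by (auto simp: is_clique_def mem_neighbors)
    then have "x \<in> verts G" by (rule adj_in_verts)
    then show "is_line G w s m C"
      using L maximal_iff size_iff \<open>finite C\<close> by (simp add: is_line_def large_maximal_def)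
  qed
qed

theorem theorem3p11:
  fixes G :: "('a, 'b) pre_digraph"
    and s m n k w e :: nat
  assumes "s > 0" and "m > 0" and "n > 0" and "k > 0" and "w > 0" and "e > 0"
    and "graph G"
    and "regular k G"
    and "\<And>x y. x \<rightarrow>\<^bsub>G\<^esub> y \<Longrightarrow> card (common_neighbors G x y) = w"
    and "\<And>x y. \<lbrakk>x \<in> verts G; y \<in> verts G; x \<noteq> y; \<not> x \<rightarrow>\<^bsub>G\<^esub> y\<rbrakk>
      \<Longrightarrow> card (common_neighbors G x y) \<le> e + 1"
    and "int w > (int s - 1) * int e + int m * int s - 1"
    and "real k < (real s + 1) * (real w + 1) - real s * (real s + 1) / 2 * real e"
    and "m * s + 1 \<ge> e + n"
    and "e > m"
    and "\<And>x. x \<in> verts G \<Longrightarrow> K_tilde_free (m + 1) n (local_graph G x)"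
  shows "(\<forall>x \<in> verts G. card {C. is_line G w s m C \<and> x \<in> C} \<le> s) \<and>
    (\<forall>x y. x \<rightarrow>\<^bsub>G\<^esub> y \<longrightarrow> (\<exists>!C. is_line G w s m C \<and> x \<in> C \<and> y \<in> C))"
proof -
  interpret graph G by fact
  have cover: "clique_cover (neighbors G x) (dominates G) s m e w" if "x \<in> verts G" for x
    by (rule local_clique_cover[of s k w e m n]) (use assms that in auto)
  show ?thesis
  proof (intro conjI ballI allI impI)
    fix x assume "x \<in> verts G"
    then interpret L: clique_cover "neighbors G x" "dominates G" s m e w by (rule cover)
    let ?lines = "{C. is_line G w s m C \<and> x \<in> C}"
    have "(\<lambda>C. C - {x}) ` ?lines \<subseteq> {L. L.large_maximal L}"
      using is_line_iff_local[OF L.clique_cover_axioms] by auto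
    moreover have "inj_on (\<lambda>C. C - {x}) ?lines"
      by (rule inj_onI) auto
    ultimately have "card ?lines \<le> card {L. L.large_maximal L}"
      by (intro card_inj_on_le L.card_large_maximal_le)
    then show "card ?lines \<le> s"
      using L.card_large_maximal_le by linarith
  next
    fix x y assume xy: "x \<rightarrow>\<^bsub>G\<^esub> y"
    then have "x \<in> verts G" by (rule adj_in_verts)
    then interpret L: clique_cover "neighbors G x" "dominates G" s m e w by (rule cover)
    have y: "y \<in> neighbors G x" and neq: "x \<noteq> y"
      using xy adj_not_same by (auto simp: mem_neighbors)
    obtain L where L: "L.large_maximal L" "y \<in> L"
      using L.ex1_large_maximal[OF y] by blast
    have "L \<subseteq> neighbors G x"
      using L by (simp add: L.large_maximal_def L.is_clique_def)
    then have "x \<notin> L"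
      using adj_not_same[of x] mem_neighbors[of x G x] by auto
    then have "insert x L - {x} = L" by simp
    then have line: "is_line G w s m (insert x L)"
      using is_line_iff_local[OF L.clique_cover_axioms, of "insert x L"] L by simp
    have unique: "C = insert x L" if C: "is_line G w s m C" "x \<in> C" "y \<in> C" for C
    proof -
      have "L.large_maximal (C - {x})"
        using is_line_iff_local[OF L.clique_cover_axioms] C by blast
      then have "C - {x} = L"
        using L.large_maximal_unique L C neq by blast
      then show ?thesis using C by blast
    qed
    show "\<exists>!C. is_line G w s m C \<and> x \<in> C \<and> y \<in> C"
    proof (rule ex1I)
      show "is_line G w s m (insert x L) \<and> x \<in> insert x L \<and> y \<in> insert x L"
        using line L by simp
    qed (use unique in blast)
  qed
qed

end
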